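(* As formal power series in $z$ and $q$, \begin{align*} &\sum_{\lambda \in \mathcal{D}}z^{\lambda_1}q^{\lambda_1+\lambda_3+\lambda_5+\dots}=\sum_{n \geq 0} \frac{z^{2n}q^{n(n+1)}}{(zq;q)_n(zq;q)_{n+1}}, \\ &\sum_{\lambda \in \mathcal{D}}z^{\lambda_1}q^{\lambda_2+\lambda_4+\lambda_6+\dots}=1+\sum_{n \geq 1} \frac{z^{2n-1}q^{n(n-1)}}{(z,zq;q)_{n}}, \\ &\sum_{\lambda \in \mathcal{P}}z^{\lambda_1}q^{\lambda_1+\lambda_3+\lambda_5+\dots}=\frac{1}{(zq;q)_{\infty}^2}, \\ &\sum_{\lambda \in \mathcal{P}}z^{\lambda_1}q^{\lambda_2+\lambda_4+\lambda_6+\dots}=\frac{1}{(1-z)(zq;q)_{\infty}^2}, \\ &\sum_{\lambda \in \diamondsuit}z^{\lambda_1}q^{\lambda_1+\lambda_4+\lambda_7 + \dots} = \frac{(-zq;q)_{\infty}}{(zq;q)^3_{\infty}}. \end{align*}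
   Context: A partition is a weakly decreasing sequence $\lambda_1\ge\lambda_2\ge\cdots$ of nonnegative integers with only finitely many nonzero terms (the empty partition has all $\lambda_i=0$). $\mathcal{P}$ is the set of all partitions and $\mathcal{D}$ the set of partitions into distinct parts (the nonzero parts are strictly decreasing). $\diamondsuit$ is the set of partition diamonds: sequences $(\lambda_1,\lambda_2,\dots)$ of nonnegative integers, all but finitely many zero, satisfying for every $k\ge 0$: $\lambda_{3k+1}\ge\lambda_{3k+2}$, $\lambda_{3k+1}\ge\lambda_{3k+3}$, $\lambda_{3k+2}\ge\lambda_{3k+4}$, $\lambda_{3k+3}\ge\lambda_{3k+4}$. $q$-Pochhammer notation: $(a;q)_n=\prod_{j=0}^{n-1}(1-aq^j)$, $(a;q)_0=1$, $(a;q)_\infty=\prod_{j\ge0}(1-aq^j)$, $(a,b;q)_n=(a;q)_n(b;q)_n$. *)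

theory Defs
  imports "HOL-Analysis.Analysis" "HOL-Computational_Algebra.Formal_Power_Series"
begin

text \<open>
  All sequences are indexed from 0, so that \<open>lam i\<close> is the part usually
  written with index \<open>i + 1\<close>.
\<close>

definition partitions :: "(nat \<Rightarrow> nat) set" where
  "partitions = {lam. (\<forall>i. lam i \<ge> lam (Suc i)) \<and> finite {i. lam i \<noteq> 0}}"

definition distinct_partitions :: "(nat \<Rightarrow> nat) set" where
  "distinct_partitions = {lam \<in> partitions. \<forall>i. lam (Suc i) \<noteq> 0 \<longrightarrow> lam i > lam (Suc i)}"

definition partition_diamonds :: "(nat \<Rightarrow> nat) set" where
  "partition_diamonds = {lam. finite {i. lam i \<noteq> 0} \<and>
     (\<forall>k. lam (3*k) \<ge> lam (3*k + 1) \<and> lam (3*k) \<ge> lam (3*k + 2) \<and>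
          lam (3*k + 1) \<ge> lam (3*k + 3) \<and> lam (3*k + 2) \<ge> lam (3*k + 3))}"

text \<open>
  Formal power series in \<open>z\<close> and \<open>q\<close> are elements of \<open>'a fps fps\<close>, with \<open>q\<close> the outer and
  \<open>z\<close> the inner variable: \<open>fps_nth (fps_nth f n) m\<close> is the coefficient of \<open>q ^ n * z ^ m\<close>.
\<close>

definition z_var :: "'a::comm_ring_1 fps fps" where
  "z_var = fps_const fps_X"

definition q_var :: "'a::comm_ring_1 fps fps" where
  "q_var = fps_X"

text \<open>
  A family of bivariate series is summable with sum \<open>S\<close> if every monomial occurs in only
  finitely many members, and \<open>S\<close> is the coefficientwise sum.  The topology on \<open>fps\<close> in the
  library is the adic one for the outer variable only, in which a sum such as that of
  all \<open>z ^ m\<close> does not converge, so \<open>(has_sum)\<close> would not do here.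
\<close>

definition has_formal_sum :: "('i \<Rightarrow> 'a::comm_ring_1 fps fps) \<Rightarrow> 'i set \<Rightarrow> 'a fps fps \<Rightarrow> bool" where
  "has_formal_sum f A S \<longleftrightarrow> (\<forall>n m. finite {x \<in> A. fps_nth (fps_nth (f x) n) m \<noteq> 0} \<and>
      fps_nth (fps_nth S n) m = (\<Sum>x | x \<in> A \<and> fps_nth (fps_nth (f x) n) m \<noteq> 0. fps_nth (fps_nth (f x) n) m))"

definition qpochhammer :: "'b::comm_ring_1 \<Rightarrow> 'b \<Rightarrow> nat \<Rightarrow> 'b" where
  "qpochhammer a q n = (\<Prod>j<n. 1 - a * q ^ j)"

text \<open>On \<open>'a fps fps\<close> this is the limit of the partial products in the \<open>q\<close>-adic topology.\<close>

definition qpochhammer_inf :: "'b::{t2_space, comm_ring_1} \<Rightarrow> 'b \<Rightarrow> 'b" where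
  "qpochhammer_inf a q = (\<Prod>j. 1 - a * q ^ j)"

end

theory Submission
  imports Defs
begin

text \<open>
  Writing a partition as a stack of layers (its conjugate), adding \<open>d\<close> to the first \<open>k + 1\<close> parts
  multiplies the weight by \<open>(z * q ^ e) ^ d\<close>, where \<open>e\<close> counts the selected indices among these
  parts. So partitions with a bounded number of parts have a finite product of geometric series as
  generating function, and requiring \<open>d > 0\<close> in every layer gives the partitions into a
  given number of distinct parts; grouping these lengths in consecutive pairs makes the summands
  of the first two series. For diamonds the layer consists of a new top value \<open>d\<close> and two middle
  values at most \<open>d\<close>, hence a factor \<open>(\<Sum>d. (d + 1)\<^sup>2 * x ^ d) = (1 + x) / (1 - x) ^ 3\<close>.
  The exponent of \<open>q\<close> alone bounds the number of parts, independently of the exponent of \<open>z\<close>,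
  so the bounded generating functions converge \<open>q\<close>-adically to the full ones.
\<close>

subsection \<open>Formal sums of bivariate power series\<close>

lemma fps_mult_nth_cong:
  assumes "\<And>i. i \<le> n \<Longrightarrow> fps_nth f i = fps_nth f' i" "\<And>i. i \<le> n \<Longrightarrow> fps_nth g i = fps_nth g' i"
  shows "fps_nth (f * g) n = fps_nth (f' * g') n"
  unfolding fps_mult_nth by (intro sum.cong arg_cong2[where f = "(*)"] assms) auto

lemma fps_fps_mult_nth:
  "fps_nth (fps_nth (f * g) n) m =
     (\<Sum>i\<le>n. \<Sum>j\<le>m. fps_nth (fps_nth f i) j * fps_nth (fps_nth g (n - i)) (m - j))"
  by (simp add: fps_mult_nth fps_sum_nth atLeast0AtMost)

text \<open>The exact support is awkward to describe in practice; any finite superset of it serves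
  as well, since the extra terms contribute zero.\<close>

lemma has_formal_sumI:
  assumes "\<And>n m. \<exists>B. finite B \<and> B \<subseteq> A \<and> (\<forall>x\<in>A - B. fps_nth (fps_nth (f x) n) m = 0) \<and>
     fps_nth (fps_nth S n) m = (\<Sum>x\<in>B. fps_nth (fps_nth (f x) n) m)"
  shows "has_formal_sum f A S"
  unfolding has_formal_sum_def
proof (intro allI)
  fix n m
  obtain B where B: "finite B" "B \<subseteq> A" "\<forall>x\<in>A - B. fps_nth (fps_nth (f x) n) m = 0"
     "fps_nth (fps_nth S n) m = (\<Sum>x\<in>B. fps_nth (fps_nth (f x) n) m)"
    using assms[of n m] by (elim exE conjE) (rule that)
  let ?C = "{x \<in> A. fps_nth (fps_nth (f x) n) m \<noteq> 0}"
  have sub: "?C \<subseteq> B" using B(3) by auto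
  have "(\<Sum>x\<in>B. fps_nth (fps_nth (f x) n) m) = (\<Sum>x\<in>?C. fps_nth (fps_nth (f x) n) m)"
    using B(1,2) sub by (intro sum.mono_neutral_right) auto
  then show "finite ?C \<and> fps_nth (fps_nth S n) m = (\<Sum>x\<in>?C. fps_nth (fps_nth (f x) n) m)"
    using finite_subset[OF sub B(1)] B(4) by simp
qed

lemma has_formal_sum_finite_support:
  "has_formal_sum f A S \<Longrightarrow> finite {x \<in> A. fps_nth (fps_nth (f x) n) m \<noteq> 0}"
  unfolding has_formal_sum_def by blast

lemma has_formal_sum_nth:
  assumes "has_formal_sum f A S" "finite B" "B \<subseteq> A" "{x \<in> A. fps_nth (fps_nth (f x) n) m \<noteq> 0} \<subseteq> B"
  shows "fps_nth (fps_nth S n) m = (\<Sum>x\<in>B. fps_nth (fps_nth (f x) n) m)"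
proof -
  have "fps_nth (fps_nth S n) m = (\<Sum>x | x \<in> A \<and> fps_nth (fps_nth (f x) n) m \<noteq> 0. fps_nth (fps_nth (f x) n) m)"
    using assms(1) unfolding has_formal_sum_def by blast
  also have "\<dots> = (\<Sum>x\<in>B. fps_nth (fps_nth (f x) n) m)"
    using assms(2-4) by (intro sum.mono_neutral_left) auto
  finally show ?thesis .
qed

lemma has_formal_sum_singleton: "has_formal_sum f {x} (f x)"
  by (rule has_formal_sumI) (auto intro!: exI[of _ "{x}"])

lemma has_formal_sum_Un_disjoint:
  assumes "has_formal_sum f A S" "has_formal_sum f B T" "A \<inter> B = {}"
  shows "has_formal_sum f (A \<union> B) (S + T)"
proof (rule has_formal_sumI)
  fix n m
  let ?s = "\<lambda>A. {x \<in> A. fps_nth (fps_nth (f x) n) m \<noteq> 0}"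
  have fin: "finite (?s A)" "finite (?s B)"
    using assms has_formal_sum_finite_support by blast+
  have "fps_nth (fps_nth (S + T) n) m = (\<Sum>x\<in>?s A \<union> ?s B. fps_nth (fps_nth (f x) n) m)"
    using assms fin by (subst sum.union_disjoint)
      (auto simp: has_formal_sum_nth[OF assms(1) fin(1)] has_formal_sum_nth[OF assms(2) fin(2)])
  with fin show "\<exists>C. finite C \<and> C \<subseteq> A \<union> B \<and> (\<forall>x\<in>A \<union> B - C. fps_nth (fps_nth (f x) n) m = 0) \<and>
     fps_nth (fps_nth (S + T) n) m = (\<Sum>x\<in>C. fps_nth (fps_nth (f x) n) m)"
    by (intro exI[of _ "?s A \<union> ?s B"]) auto
qed

lemma has_formal_sum_reindex:
  assumes "has_formal_sum g A S" "bij_betw h A B" "\<And>x. x \<in> A \<Longrightarrow> f (h x) = g x"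
  shows "has_formal_sum f B S"
proof (rule has_formal_sumI)
  fix n m
  let ?s = "{x \<in> A. fps_nth (fps_nth (g x) n) m \<noteq> 0}"
  have fin: "finite ?s" using assms has_formal_sum_finite_support by blast
  have inj: "inj_on h ?s" by (rule inj_on_subset[of h A]) (use assms(2) in \<open>auto simp: bij_betw_def\<close>)
  have B: "B = h ` A" using assms(2) by (simp add: bij_betw_def)
  have "fps_nth (fps_nth S n) m = (\<Sum>x\<in>h ` ?s. fps_nth (fps_nth (f x) n) m)"
    using inj fin assms(3) by (simp add: sum.reindex has_formal_sum_nth[OF assms(1) fin])
  then show "\<exists>C. finite C \<and> C \<subseteq> B \<and> (\<forall>x\<in>B - C. fps_nth (fps_nth (f x) n) m = 0) \<and>
     fps_nth (fps_nth S n) m = (\<Sum>x\<in>C. fps_nth (fps_nth (f x) n) m)"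
    using fin assms(3) by (intro exI[of _ "h ` ?s"]) (auto simp: B)
qed

text \<open>A coefficient of a product in degree \<open>(n, m)\<close> involves only coefficients of
  the factors in degrees at most \<open>n\<close> and \<open>m\<close>. Finitely many members of
  each family reach those degrees, so both sums can be replaced by finite ones.\<close>

lemma has_formal_sum_times:
  assumes "has_formal_sum f A S" "has_formal_sum g B T"
  shows "has_formal_sum (\<lambda>(x, y). f x * g y) (A \<times> B) (S * T)"
proof (rule has_formal_sumI)
  fix n m
  define X where "X = (\<Union>i\<le>n. \<Union>j\<le>m. {x \<in> A. fps_nth (fps_nth (f x) i) j \<noteq> 0})"
  define Y where "Y = (\<Union>i\<le>n. \<Union>j\<le>m. {y \<in> B. fps_nth (fps_nth (g y) i) j \<noteq> 0})"
  have X: "finite X" "X \<subseteq> A" "\<And>i j x. i \<le> n \<Longrightarrow> j \<le> m \<Longrightarrow> x \<in> A - X \<Longrightarrow> fps_nth (fps_nth (f x) i) j = 0"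
    unfolding X_def using has_formal_sum_finite_support[OF assms(1)] by auto
  have Y: "finite Y" "Y \<subseteq> B" "\<And>i j x. i \<le> n \<Longrightarrow> j \<le> m \<Longrightarrow> x \<in> B - Y \<Longrightarrow> fps_nth (fps_nth (g x) i) j = 0"
    unfolding Y_def using has_formal_sum_finite_support[OF assms(2)] by auto
  have S: "fps_nth (fps_nth S i) j = fps_nth (fps_nth (\<Sum>x\<in>X. f x) i) j" if "i \<le> n" "j \<le> m" for i j
    using X(3)[OF that] by (subst has_formal_sum_nth[OF assms(1) X(1,2)]) (auto simp: fps_sum_nth)
  have T: "fps_nth (fps_nth T i) j = fps_nth (fps_nth (\<Sum>x\<in>Y. g x) i) j" if "i \<le> n" "j \<le> m" for i j
    using Y(3)[OF that] by (subst has_formal_sum_nth[OF assms(2) Y(1,2)]) (auto simp: fps_sum_nth)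
  have "fps_nth (fps_nth (S * T) n) m = fps_nth (fps_nth ((\<Sum>x\<in>X. f x) * (\<Sum>y\<in>Y. g y)) n) m"
    unfolding fps_fps_mult_nth
    by (intro sum.cong arg_cong2[where f = "(*)"] S T) auto
  also have "\<dots> = (\<Sum>p\<in>X \<times> Y. fps_nth (fps_nth (case p of (x, y) \<Rightarrow> f x * g y) n) m)"
    by (simp add: sum_product sum.cartesian_product fps_sum_nth case_prod_unfold)
  finally have "fps_nth (fps_nth (S * T) n) m = \<dots>" .
  moreover have "fps_nth (fps_nth (f x * g y) n) m = 0" if "(x, y) \<in> A \<times> B - X \<times> Y" for x y
    unfolding fps_fps_mult_nth
  proof (intro sum.neutral ballI)
    fix i j assume ij: "i \<in> {..n}" "j \<in> {..m}"
    from that consider "x \<in> A - X" | "y \<in> B - Y" by auto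
    then show "fps_nth (fps_nth (f x) i) j * fps_nth (fps_nth (g y) (n - i)) (m - j) = 0"
      by cases (use ij X(3) Y(3) in auto)
  qed
  ultimately show "\<exists>C. finite C \<and> C \<subseteq> A \<times> B \<and>
     (\<forall>p\<in>A \<times> B - C. fps_nth (fps_nth (case p of (x, y) \<Rightarrow> f x * g y) n) m = 0) \<and>
     fps_nth (fps_nth (S * T) n) m = (\<Sum>p\<in>C. fps_nth (fps_nth (case p of (x, y) \<Rightarrow> f x * g y) n) m)"
    using X(1,2) Y(1,2) by (intro exI[of _ "X \<times> Y"]) auto
qed

text \<open>For each \<open>n\<close> the sets \<open>A k\<close> eventually agree with
  \<open>B\<close> on all indices that contribute to \<open>q ^ n\<close>, so coefficient
  \<open>n\<close> of \<open>S k\<close> becomes constant. The agreement is uniform in the exponent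
  of \<open>z\<close>, as q-adic convergence demands.\<close>

lemma has_formal_sum_limit:
  assumes S: "\<And>k. has_formal_sum f (A k) (S k)"
    and ev: "\<And>n. \<forall>\<^sub>F k in sequentially. \<forall>x. fps_nth (f x) n \<noteq> 0 \<longrightarrow> (x \<in> A k \<longleftrightarrow> x \<in> B)"
  shows "\<exists>T. has_formal_sum f B T \<and> S \<longlonglongrightarrow> T"
proof -
  have "\<exists>K. \<forall>k\<ge>K. \<forall>x. fps_nth (f x) n \<noteq> 0 \<longrightarrow> (x \<in> A k \<longleftrightarrow> x \<in> B)" for n
    using ev[of n] by (simp add: eventually_sequentially)
  then obtain K where K: "\<And>n k x. k \<ge> K n \<Longrightarrow> fps_nth (f x) n \<noteq> 0 \<Longrightarrow> x \<in> A k \<longleftrightarrow> x \<in> B"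
    by metis
  \<comment> \<open>Coefficient \<open>n\<close> is read off at the stage \<open>K n\<close> from
    which it no longer changes.\<close>
  define T where "T = Abs_fps (\<lambda>n. fps_nth (S (K n)) n)"
  have supp: "{x \<in> A k. fps_nth (fps_nth (f x) n) m \<noteq> 0} = {x \<in> B. fps_nth (fps_nth (f x) n) m \<noteq> 0}"
    if "k \<ge> K n" for k n m
  proof -
    have "fps_nth (f x) n \<noteq> 0" if "fps_nth (fps_nth (f x) n) m \<noteq> 0" for x
      using that by auto
    then show ?thesis using K[OF that] by blast
  qed
  have Seq: "fps_nth (S k) n = fps_nth T n" if "k \<ge> K n" for k n
    using S supp[OF that] supp[of n "K n"] unfolding has_formal_sum_def
    by (simp add: T_def fps_eq_iff)
  have "has_formal_sum f B T"
    unfolding has_formal_sum_def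
  proof (intro allI)
    fix n m
    have "finite {x \<in> A (K n). fps_nth (fps_nth (f x) n) m \<noteq> 0} \<and> fps_nth (fps_nth (S (K n)) n) m =
        (\<Sum>x | x \<in> A (K n) \<and> fps_nth (fps_nth (f x) n) m \<noteq> 0. fps_nth (fps_nth (f x) n) m)"
      using S[of "K n"] unfolding has_formal_sum_def by blast
    then show "finite {x \<in> B. fps_nth (fps_nth (f x) n) m \<noteq> 0} \<and> fps_nth (fps_nth T n) m =
        (\<Sum>x | x \<in> B \<and> fps_nth (fps_nth (f x) n) m \<noteq> 0. fps_nth (fps_nth (f x) n) m)"
      unfolding supp[OF order.refl] by (simp add: T_def)
  qed
  moreover have "S \<longlonglongrightarrow> T"
    by (rule tendsto_fpsI) (auto simp: eventually_sequentially intro: Seq)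
  ultimately show ?thesis by blast
qed

subsection \<open>Limits and q-Pochhammer symbols\<close>

text \<open>Coefficient \<open>n\<close> of a product depends only on the coefficients up to
  \<open>n\<close>, all of which are eventually constant.\<close>

lemma tendsto_mult_fps:
  fixes f g :: "'b \<Rightarrow> 'a::comm_ring_1 fps"
  assumes "(f \<longlongrightarrow> a) F" "(g \<longlongrightarrow> b) F"
  shows "((\<lambda>x. f x * g x) \<longlongrightarrow> a * b) F"
proof (rule tendsto_fpsI)
  fix n
  have "\<forall>\<^sub>F x in F. \<forall>i\<in>{..n}. fps_nth (f x) i = fps_nth a i \<and> fps_nth (g x) i = fps_nth b i"
    using assms unfolding tendsto_fps_iff by (auto intro!: eventually_ball_finite eventually_conj)
  then show "\<forall>\<^sub>F x in F. fps_nth (f x * g x) n = fps_nth (a * b) n"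
    by eventually_elim (intro fps_mult_nth_cong, auto)
qed

lemma tendsto_power_fps:
  fixes f :: "'b \<Rightarrow> 'a::comm_ring_1 fps"
  assumes "(f \<longlongrightarrow> a) F"
  shows "((\<lambda>x. f x ^ n) \<longlongrightarrow> a ^ n) F"
  by (induction n) (auto intro: tendsto_mult_fps assms)

lemma qpochhammer_0 [simp]: "qpochhammer a q 0 = 1"
  by (simp add: qpochhammer_def)

lemma qpochhammer_Suc: "qpochhammer a q (Suc n) = qpochhammer a q n * (1 - a * q ^ n)"
  by (simp add: qpochhammer_def)

text \<open>As \<open>a\<close> has no constant term, the factor with index \<open>n\<close> alters
  only coefficients beyond \<open>n\<close>, so every coefficient of the finite products
  stabilizes.\<close>

lemma qpochhammer_tendsto:
  fixes a :: "'a::idom fps"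
  assumes "fps_nth a 0 = 0"
  shows "(\<lambda>n. qpochhammer a fps_X n) \<longlonglongrightarrow> qpochhammer_inf a fps_X"
    and "fps_nth (qpochhammer_inf a fps_X) 0 = 1"
proof -
  let ?p = "\<lambda>n. qpochhammer a fps_X n"
  have step: "fps_nth (?p (Suc n)) m = fps_nth (?p n) m" if "m \<le> n" for m n
  proof -
    have "fps_nth (?p n * (a * fps_X ^ n)) m = fps_nth ((?p n * a) * fps_X ^ n) m"
      by (simp add: mult_ac)
    also have "\<dots> = 0"
      using that assms by (auto simp: fps_X_power_mult_right_nth)
    finally show ?thesis by (simp add: qpochhammer_Suc algebra_simps)
  qed
  have stable: "fps_nth (?p n) m = fps_nth (?p m) m" if "m \<le> n" for m n
    using that by (induction rule: dec_induct) (auto simp: step)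
  define P where "P = Abs_fps (\<lambda>m. fps_nth (?p m) m)"
  have P: "?p \<longlonglongrightarrow> P"
    by (rule tendsto_fpsI) (auto simp: eventually_sequentially P_def intro: stable)
  have P0: "fps_nth P 0 = 1" by (simp add: P_def)
  \<comment> \<open>\<open>has_prod\<close> asks for a nonzero limit, which \<open>P0\<close>
    supplies; \<open>LIMSEQ_Suc\<close> accounts for its partial products including the factor with
    index \<open>n\<close>.\<close>
  have "(\<lambda>j. 1 - a * fps_X ^ j) has_prod P"
    unfolding has_prod_def raw_has_prod_def
    using LIMSEQ_Suc[OF P] P0 by (auto simp: qpochhammer_def lessThan_Suc_atMost)
  then have "qpochhammer_inf a fps_X = P"
    unfolding qpochhammer_inf_def by (metis has_prod_unique)
  with P P0 show "?p \<longlonglongrightarrow> qpochhammer_inf a fps_X" "fps_nth (qpochhammer_inf a fps_X) 0 = 1"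
    by simp_all
qed

text \<open>The coefficient ring \<open>'a fps\<close> is not a field, so invertibility is lifted
  twice: a nonzero constant term in \<open>z\<close> makes the \<open>q\<close>-constant coefficient
  a unit, and this makes \<open>g\<close> a unit.\<close>

lemma fps_fps_divide_eqI:
  fixes f g h :: "'a::field fps fps"
  assumes "h * g = f" "fps_nth (fps_nth g 0) 0 \<noteq> 0"
  shows "f / g = h"
proof -
  have "fps_nth g 0 * inverse (fps_nth g 0) = 1"
    using assms(2) by (rule inverse_mult_eq_1')
  then have "g * inverse g = 1"
    unfolding fps_inverse_def by (rule fps_right_inverse)
  moreover have "subdegree g = 0"
    using assms(2) by (auto simp: subdegree_eq_0_iff)
  ultimately show ?thesis
    by (simp add: fps_divide_unit' assms(1)[symmetric] mult.assoc)
qed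


subsection \<open>The geometric series in \<open>z * q ^ e\<close>\<close>

lemma has_formal_sum_unique:
  assumes "has_formal_sum f A S" "has_formal_sum f A T"
  shows "S = T"
  using assms unfolding has_formal_sum_def by (simp add: fps_eq_iff)

lemma has_formal_sum_cmult:
  assumes "has_formal_sum f A S"
  shows "has_formal_sum (\<lambda>x. c * f x) A (c * S)"
  by (rule has_formal_sum_reindex[OF has_formal_sum_times[OF has_formal_sum_singleton[of "\<lambda>_. c" "()"] assms],
        where h = snd]) (auto simp: bij_betw_def inj_on_def)

lemma z_power_mult_q_power_nth:
  "fps_nth (fps_nth (z_var ^ a * q_var ^ b) n) m = (if n = b \<and> m = a then 1 else 0)"
  by (simp add: z_var_def q_var_def fps_const_power fps_X_power_mult_right_nth del: fps_const_power)
     (auto simp: fps_const_power)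

text \<open>The powers \<open>x ^ d\<close> are monomials with pairwise different exponents of
  \<open>z\<close>, so they are summable even for \<open>e = 0\<close>, where q-adic convergence
  fails.\<close>

lemma has_formal_sum_geometric:
  fixes e :: nat
  defines "x \<equiv> z_var * q_var ^ e :: 'a::comm_ring_1 fps fps"
  obtains G
  where "has_formal_sum (\<lambda>d. x ^ d) UNIV G" "G * (1 - x) = 1"
proof -
  have nth: "fps_nth (fps_nth (x ^ d) n) m = (if n = e * d \<and> m = d then 1 else 0)" for d n m
    by (simp add: x_def power_mult_distrib flip: power_mult z_power_mult_q_power_nth)
  define G where "G = Abs_fps (\<lambda>n. Abs_fps (\<lambda>m. if n = e * m then 1 else 0 :: 'a))"
  have G: "has_formal_sum (\<lambda>d. x ^ d) UNIV G"
  proof (rule has_formal_sumI)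
    fix n m
    show "\<exists>B. finite B \<and> B \<subseteq> UNIV \<and> (\<forall>d\<in>UNIV - B. fps_nth (fps_nth (x ^ d) n) m = 0) \<and>
      fps_nth (fps_nth G n) m = (\<Sum>d\<in>B. fps_nth (fps_nth (x ^ d) n) m)"
      by (intro exI[of _ "{m}"]) (auto simp: nth G_def)
  qed
  \<comment> \<open>Shifting the index by one multiplies the sum by \<open>x\<close>; splitting off
    \<open>d = 0\<close> then gives \<open>G = 1 + x * G\<close>.\<close>
  have "has_formal_sum (\<lambda>d. x ^ d) (range Suc) (x * G)"
    by (rule has_formal_sum_reindex[OF has_formal_sum_cmult[OF G], where h = Suc])
       (auto simp: bij_betw_def)
  from has_formal_sum_Un_disjoint[OF has_formal_sum_singleton[of _ 0] this]
  have "has_formal_sum (\<lambda>d. x ^ d) ({0} \<union> range Suc) (1 + x * G)"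
    by auto
  moreover have "{0} \<union> range Suc = UNIV" by (auto simp: image_iff) (metis not0_implies_Suc)
  ultimately have "G = 1 + x * G" using has_formal_sum_unique[OF G] by metis
  then have "G * (1 - x) = 1" by (simp add: algebra_simps)
  with G show ?thesis by (rule that)
qed

subsection \<open>Adding a layer to a partition\<close>

text \<open>The map \<open>g\<close> enumerates the positions of the parts that are counted by \<open>q\<close>.\<close>

definition weight :: "(nat \<Rightarrow> nat) \<Rightarrow> (nat \<Rightarrow> nat) \<Rightarrow> 'a::comm_ring_1 fps fps" where
  "weight g lam = z_var ^ lam 0 * q_var ^ (\<Sum>i. lam (g i))"

definition add_layer :: "nat \<Rightarrow> nat \<Rightarrow> (nat \<Rightarrow> nat) \<Rightarrow> nat \<Rightarrow> nat" where
  "add_layer c d lam = (\<lambda>i. lam i + (if i < c then d else 0))"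

lemma weight_nth_nonzero:
  assumes "fps_nth (weight g lam) n \<noteq> 0" (is "fps_nth ?w n \<noteq> 0")
  shows "(\<Sum>i. lam (g i)) = n"
proof -
  have "\<exists>m. fps_nth (fps_nth ?w n) m \<noteq> 0"
    using assms by (auto simp: fps_eq_iff)
  then show ?thesis unfolding weight_def z_power_mult_q_power_nth by presburger
qed

text \<open>Of the positions enumerated by \<open>g\<close>, the first \<open>e\<close> are raised
  by \<open>d\<close>, and so is position 0 because \<open>c > 0\<close>.\<close>

lemma weight_add_layer:
  assumes fin: "finite {i. lam i \<noteq> 0}" and g: "inj g" "{i. g i < c} = {..<e}" and c: "c > 0"
  shows "weight g (add_layer c d lam) = weight g lam * (z_var * q_var ^ e) ^ d"
proof -
  have fin': "finite {i. lam (g i) \<noteq> 0}"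
    using finite_vimageI[OF fin g(1)] by (simp add: vimage_def)
  have "g i < c \<longleftrightarrow> i < e" for i using g(2) by (simp add: set_eq_iff)
  then have "(\<Sum>i. add_layer c d lam (g i)) = (\<Sum>i. lam (g i) + (if i \<in> {..<e} then d else 0))"
    by (simp add: add_layer_def)
  also have "\<dots> = (\<Sum>i. lam (g i)) + (\<Sum>i. if i \<in> {..<e} then d else 0)"
    using fin' by (intro suminf_add[symmetric] summable_finite[of "{..<e}"]
        summable_finite[of "{i. lam (g i) \<noteq> 0}"]) auto
  also have "(\<Sum>i. if i \<in> {..<e} then d else 0) = e * d"
    by (subst suminf_finite[of "{..<e}"]) auto
  finally have "(\<Sum>i. add_layer c d lam (g i)) = (\<Sum>i. lam (g i)) + e * d" .
  moreover have "add_layer c d lam 0 = lam 0 + d" using c by (simp add: add_layer_def)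
  ultimately show ?thesis
    by (simp add: weight_def power_add power_mult_distrib mult_ac flip: power_mult)
qed

section \<open>Basic properties of partitions\<close>

lemma partitions_antimono:
  assumes "lam \<in> partitions" "i \<le> j"
  shows "lam j \<le> lam i"
  using assms lift_Suc_antimono_le[of lam i j] by (simp add: partitions_def)

lemma finite_support_partition: "lam \<in> partitions \<Longrightarrow> finite {i. lam i \<noteq> 0}"
  by (simp add: partitions_def)

lemma partitionsI:
  assumes "\<And>i. lam (Suc i) \<le> lam i" "lam k = 0"
  shows "lam \<in> partitions"
proof -
  have "lam i = 0" if "k \<le> i" for i
    using lift_Suc_antimono_le[of lam k i] assms that by simp
  then have "{i. lam i \<noteq> 0} \<subseteq> {..<k}"
    by (metis (mono_tags, lifting) lessThan_iff mem_Collect_eq not_less subsetI)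
  then show ?thesis using assms finite_subset unfolding partitions_def by blast
qed

text \<open>If the value at the sum \<open>n\<close> were nonzero, all \<open>n + 1\<close> values
  up to index \<open>n\<close> would be at least 1 and would add up to more than
  \<open>n\<close>.\<close>

lemma antimono_eq_0_at_sum:
  fixes f :: "nat \<Rightarrow> nat"
  assumes "finite {i. f i \<noteq> 0}" "\<And>i. f (Suc i) \<le> f i"
  shows "f (\<Sum>i. f i) = 0"
proof (rule ccontr)
  define n where "n = (\<Sum>i. f i)"
  assume "f (\<Sum>i. f i) \<noteq> 0"
  then have "f n \<noteq> 0" by (simp add: n_def)
  then have "f i \<ge> 1" if "i \<le> n" for i
    using lift_Suc_antimono_le[of f, OF assms(2) that] by simp
  then have "(\<Sum>i\<le>n. 1) \<le> (\<Sum>i\<le>n. f i)" by (intro sum_mono) auto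
  also have "\<dots> \<le> (\<Sum>i. f i)"
    by (rule sum_le_suminf) (use assms(1) in \<open>auto intro!: summable_finite[of "{i. f i \<noteq> 0}"]\<close>)
  finally show False by (simp add: n_def)
qed

text \<open>As the parts decrease weakly, a zero at index \<open>k\<close> means at most
  \<open>k\<close> nonzero parts.\<close>

definition bounded_partitions :: "nat \<Rightarrow> (nat \<Rightarrow> nat) set" where
  "bounded_partitions k = {lam \<in> partitions. lam k = 0}"

definition distinct_partitions_length :: "nat \<Rightarrow> (nat \<Rightarrow> nat) set" where
  "distinct_partitions_length k = {lam \<in> distinct_partitions. lam k = 0 \<and> (\<forall>i<k. lam i \<noteq> 0)}"

lemma bounded_partitions_0: "bounded_partitions 0 = {\<lambda>_. 0}"
proof -
  have "lam = (\<lambda>_. 0)" if "lam \<in> bounded_partitions 0" for lam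
    using that partitions_antimono[of lam 0] by (simp add: bounded_partitions_def fun_eq_iff)
  moreover have "(\<lambda>_. 0) \<in> bounded_partitions 0"
    by (simp add: bounded_partitions_def partitions_def)
  ultimately show ?thesis by blast
qed

text \<open>A partition with at most \<open>k\<close> parts is zero at index \<open>k\<close>, so
  after a layer of length \<open>k + 1\<close> is added that entry is the height \<open>d\<close>.
  Subtracting it again from the first \<open>k + 1\<close> entries inverts the map.\<close>

lemma bij_betw_bounded_partitions:
  "bij_betw (\<lambda>(lam, d). add_layer (Suc k) d lam) (bounded_partitions k \<times> UNIV) (bounded_partitions (Suc k))"
proof (rule bij_betw_byWitness[where f' = "\<lambda>mu. (\<lambda>i. mu i - (if i < Suc k then mu k else 0), mu k)"])
  show "\<forall>a\<in>bounded_partitions k \<times> UNIV. (\<lambda>mu. (\<lambda>i. mu i - (if i < Suc k then mu k else 0), mu k))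
     (case a of (lam, d) \<Rightarrow> add_layer (Suc k) d lam) = a"
    by (auto simp: add_layer_def bounded_partitions_def fun_eq_iff)
  show "\<forall>mu\<in>bounded_partitions (Suc k). (case (\<lambda>i. mu i - (if i < Suc k then mu k else 0), mu k) of
      (lam, d) \<Rightarrow> add_layer (Suc k) d lam) = mu"
  proof
    fix mu assume "mu \<in> bounded_partitions (Suc k)"
    then have "mu k \<le> mu i" if "i < Suc k" for i
      using partitions_antimono[of mu i k] that by (simp add: bounded_partitions_def)
    then show "(case (\<lambda>i. mu i - (if i < Suc k then mu k else 0), mu k) of
      (lam, d) \<Rightarrow> add_layer (Suc k) d lam) = mu"
      by (simp add: add_layer_def fun_eq_iff)
  qed
  show "(\<lambda>(lam, d). add_layer (Suc k) d lam) ` (bounded_partitions k \<times> UNIV) \<subseteq> bounded_partitions (Suc k)"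
  proof safe
    fix lam d assume lam: "lam \<in> bounded_partitions k"
    have z: "add_layer (Suc k) d lam (Suc k) = 0"
      using lam partitions_antimono[of lam k "Suc k"] by (simp add: add_layer_def bounded_partitions_def)
    moreover have "add_layer (Suc k) d lam (Suc i) \<le> add_layer (Suc k) d lam i" for i
      using lam partitions_antimono[of lam i "Suc i"] by (simp add: add_layer_def bounded_partitions_def)
    ultimately show "add_layer (Suc k) d lam \<in> bounded_partitions (Suc k)"
      by (auto simp: bounded_partitions_def intro: partitionsI)
  qed
  show "(\<lambda>mu. (\<lambda>i. mu i - (if i < Suc k then mu k else 0), mu k)) ` bounded_partitions (Suc k)
      \<subseteq> bounded_partitions k \<times> UNIV"
  proof safe
    fix mu assume mu: "mu \<in> bounded_partitions (Suc k)"
    let ?l = "\<lambda>i. mu i - (if i < Suc k then mu k else 0)"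
    \<comment> \<open>At \<open>i = k\<close> the entry \<open>Suc i\<close> lies outside the
      subtracted range, but there \<open>mu (Suc k) = 0\<close>.\<close>
    have "?l (Suc i) \<le> ?l i" for i
      using mu partitions_antimono[of mu i "Suc i"]
      by (cases "i = k") (auto simp: bounded_partitions_def intro: diff_le_mono)
    then show "?l \<in> bounded_partitions k"
      by (auto simp: bounded_partitions_def intro: partitionsI[of _ k])
  qed simp
qed

lemma distinct_partitions_length_0: "distinct_partitions_length 0 = {\<lambda>_. 0}"
  using bounded_partitions_0
  by (auto simp: distinct_partitions_length_def distinct_partitions_def bounded_partitions_def)

text \<open>A layer keeps the differences among the first \<open>k + 1\<close> entries and puts
  \<open>d\<close> at index \<open>k\<close>. So the bijection above restricts: strictness and exact
  length carry over in both directions precisely when \<open>d > 0\<close>.\<close>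

lemma bij_betw_distinct_partitions_length:
  "bij_betw (\<lambda>(lam, d). add_layer (Suc k) d lam) (distinct_partitions_length k \<times> range Suc)
     (distinct_partitions_length (Suc k))"
proof (rule bij_betw_subset[OF bij_betw_bounded_partitions])
  show "distinct_partitions_length k \<times> range Suc \<subseteq> bounded_partitions k \<times> UNIV"
    by (auto simp: distinct_partitions_length_def distinct_partitions_def bounded_partitions_def)
  have *: "add_layer (Suc k) d lam \<in> distinct_partitions_length (Suc k) \<longleftrightarrow>
      lam \<in> distinct_partitions_length k \<and> d > 0" if "lam \<in> bounded_partitions k" for lam d
  proof -
    have lam: "lam \<in> partitions" "lam k = 0" using that by (auto simp: bounded_partitions_def)
    have z: "lam i = 0" if "i \<ge> k" for i using partitions_antimono[OF lam(1) that] lam(2) by simp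
    have add: "add_layer (Suc k) d lam \<in> bounded_partitions (Suc k)"
      using bij_betwE[OF bij_betw_bounded_partitions] that by fastforce
    show ?thesis
    proof
      assume l: "add_layer (Suc k) d lam \<in> distinct_partitions_length (Suc k)"
      have d: "d > 0" using l lam by (auto simp: distinct_partitions_length_def add_layer_def)
      \<comment> \<open>Both indices lie inside the layer, so \<open>d\<close> cancels. These strict
        drops also force the first \<open>k\<close> entries of \<open>lam\<close> to be
        nonzero.\<close>
      have lt: "lam (Suc i) < lam i" if "i < k" for i
      proof -
        have "add_layer (Suc k) d lam (Suc i) \<noteq> 0"
          using d that by (simp add: add_layer_def)
        then have "add_layer (Suc k) d lam (Suc i) < add_layer (Suc k) d lam i"
          using l unfolding distinct_partitions_length_def distinct_partitions_def by blast
        then show ?thesis using that by (simp add: add_layer_def)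
      qed
      have "lam (Suc i) < lam i" if "lam (Suc i) \<noteq> 0" for i
        using that z[of "Suc i"] by (intro lt) force
      moreover have "lam i \<noteq> 0" if "i < k" for i
        using lt[OF that] by simp
      ultimately show "lam \<in> distinct_partitions_length k \<and> d > 0"
        using lam d by (simp add: distinct_partitions_length_def distinct_partitions_def)
    next
      assume "lam \<in> distinct_partitions_length k \<and> d > 0"
      then have l: "lam \<in> distinct_partitions_length k" and d: "d > 0" by auto
      have "add_layer (Suc k) d lam (Suc i) < add_layer (Suc k) d lam i"
        if "add_layer (Suc k) d lam (Suc i) \<noteq> 0" for i
      proof -
        have i: "i < k" using that z[of "Suc i"] by (force simp: add_layer_def split: if_splits)
        \<comment> \<open>If \<open>lam (Suc i) = 0\<close>, the drop comes from
          \<open>lam i\<close> being nonzero for \<open>i < k\<close>.\<close>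
        then have "lam (Suc i) < lam i"
          using l by (cases "lam (Suc i) = 0") (auto simp: distinct_partitions_length_def distinct_partitions_def)
        with i show ?thesis by (simp add: add_layer_def)
      qed
      then show "add_layer (Suc k) d lam \<in> distinct_partitions_length (Suc k)"
        using add d
        by (auto simp: distinct_partitions_length_def distinct_partitions_def bounded_partitions_def)
           (simp add: add_layer_def)
    qed
  qed
  have sub: "distinct_partitions_length j \<subseteq> bounded_partitions j" for j
    by (auto simp: distinct_partitions_length_def distinct_partitions_def bounded_partitions_def)
  show "(\<lambda>(lam, d). add_layer (Suc k) d lam) ` (distinct_partitions_length k \<times> range Suc) =
      distinct_partitions_length (Suc k)"
  proof (intro equalityI subsetI)
    fix mu assume mu: "mu \<in> distinct_partitions_length (Suc k)"
    then have "mu \<in> (\<lambda>(lam, d). add_layer (Suc k) d lam) ` (bounded_partitions k \<times> UNIV)"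
      unfolding bij_betw_imp_surj_on[OF bij_betw_bounded_partitions[of k]] using sub by blast
    then obtain lam d where "lam \<in> bounded_partitions k" "mu = add_layer (Suc k) d lam" by auto
    with mu * show "mu \<in> (\<lambda>(lam, d). add_layer (Suc k) d lam) ` (distinct_partitions_length k \<times> range Suc)"
      by (auto intro!: image_eqI[of _ _ "(lam, d)"] simp: gr0_conv_Suc)
  next
    fix mu assume "mu \<in> (\<lambda>(lam, d). add_layer (Suc k) d lam) ` (distinct_partitions_length k \<times> range Suc)"
    then show "mu \<in> distinct_partitions_length (Suc k)" using * sub by auto
  qed
qed


section \<open>Generating functions for a bounded number of parts\<close>

lemma weight_zero [simp]: "weight g (\<lambda>_. 0) = 1"
  by (simp add: weight_def)

text \<open>The layer of length \<open>j + 1\<close> covers \<open>e j\<close> counted positions and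
  has a free height, hence contributes a geometric series. Keeping the denominator on the left
  avoids division until the limit is taken.\<close>

lemma has_formal_sum_bounded_partitions:
  assumes g: "inj g" "\<And>k. {i. g i < Suc k} = {..<e k}"
  shows "\<exists>S :: 'a::comm_ring_1 fps fps. has_formal_sum (weight g) (bounded_partitions k) S \<and>
    S * (\<Prod>j<k. 1 - z_var * q_var ^ e j) = 1"
proof (induction k)
  case 0
  show ?case
    using has_formal_sum_singleton[of "weight g" "\<lambda>_. 0"] by (auto simp: bounded_partitions_0)
next
  case (Suc k)
  then obtain S :: "'a fps fps" where S: "has_formal_sum (weight g) (bounded_partitions k) S"
    "S * (\<Prod>j<k. 1 - z_var * q_var ^ e j) = 1" by blast
  obtain G :: "'a fps fps" where G: "has_formal_sum (\<lambda>d. (z_var * q_var ^ e k) ^ d) UNIV G"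
    "G * (1 - z_var * q_var ^ e k) = 1" by (rule has_formal_sum_geometric)
  have "has_formal_sum (weight g) (bounded_partitions (Suc k)) (S * G)"
    by (rule has_formal_sum_reindex[OF has_formal_sum_times[OF S(1) G(1)] bij_betw_bounded_partitions])
       (auto intro!: weight_add_layer g simp: bounded_partitions_def partitions_def)
  moreover have "S * G * (\<Prod>j<Suc k. 1 - z_var * q_var ^ e j) =
      (S * (\<Prod>j<k. 1 - z_var * q_var ^ e j)) * (G * (1 - z_var * q_var ^ e k))"
    by (simp add: mult_ac)
  ultimately show ?case by (auto simp: S(2) G(2))
qed

text \<open>Heights now start at 1, so each layer contributes \<open>x / (1 - x)\<close> in place of
  \<open>1 / (1 - x)\<close>.\<close>

lemma has_formal_sum_distinct_partitions_length:
  assumes g: "inj g" "\<And>k. {i. g i < Suc k} = {..<e k}"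
  shows "\<exists>S :: 'a::comm_ring_1 fps fps. has_formal_sum (weight g) (distinct_partitions_length k) S \<and>
    S * (\<Prod>j<k. 1 - z_var * q_var ^ e j) = (\<Prod>j<k. z_var * q_var ^ e j)"
proof (induction k)
  case 0
  show ?case
    using has_formal_sum_singleton[of "weight g" "\<lambda>_. 0"] by (auto simp: distinct_partitions_length_0)
next
  case (Suc k)
  let ?x = "z_var * q_var ^ e k :: 'a fps fps"
  from Suc obtain S :: "'a fps fps" where S: "has_formal_sum (weight g) (distinct_partitions_length k) S"
    "S * (\<Prod>j<k. 1 - z_var * q_var ^ e j) = (\<Prod>j<k. z_var * q_var ^ e j)" by blast
  obtain G :: "'a fps fps" where G: "has_formal_sum (\<lambda>d. ?x ^ d) UNIV G"
    "G * (1 - ?x) = 1" by (rule has_formal_sum_geometric)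
  have G': "has_formal_sum (\<lambda>d. ?x ^ d) (range Suc) (?x * G)"
    by (rule has_formal_sum_reindex[OF has_formal_sum_cmult[OF G(1)], where h = Suc])
       (auto simp: bij_betw_def)
  have "has_formal_sum (weight g) (distinct_partitions_length (Suc k)) (S * (?x * G))"
    by (rule has_formal_sum_reindex[OF has_formal_sum_times[OF S(1) G'] bij_betw_distinct_partitions_length])
       (auto intro!: weight_add_layer g
             simp: distinct_partitions_length_def distinct_partitions_def partitions_def
             simp del: power_Suc)
  moreover have "S * (?x * G) * (\<Prod>j<Suc k. 1 - z_var * q_var ^ e j) =
      (S * (\<Prod>j<k. 1 - z_var * q_var ^ e j)) * ?x * (G * (1 - ?x))"
    by (simp add: mult_ac)
  ultimately show ?case by (auto simp: S(2) G(2) mult.assoc)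
qed

text \<open>Over the common denominator the two lengths share the numerator product over
  \<open>j < k\<close>; their remaining factors are \<open>1 - x\<close> and \<open>x\<close> with
  \<open>x = z_var * q_var ^ e k\<close>, which add up to 1.\<close>

lemma has_formal_sum_distinct_partitions_length_or_Suc:
  assumes g: "inj g" "\<And>k. {i. g i < Suc k} = {..<e k}"
  shows "\<exists>S :: 'a::idom fps fps.
    has_formal_sum (weight g) (distinct_partitions_length k \<union> distinct_partitions_length (Suc k)) S \<and>
    S * (\<Prod>j<Suc k. 1 - z_var * q_var ^ e j) = (\<Prod>j<k. z_var * q_var ^ e j)"
proof -
  obtain S :: "'a fps fps" where S: "has_formal_sum (weight g) (distinct_partitions_length k) S"
    "S * (\<Prod>j<k. 1 - z_var * q_var ^ e j) = (\<Prod>j<k. z_var * q_var ^ e j)"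
    using has_formal_sum_distinct_partitions_length[OF assms] by blast
  obtain T :: "'a fps fps" where T: "has_formal_sum (weight g) (distinct_partitions_length (Suc k)) T"
    "T * (\<Prod>j<Suc k. 1 - z_var * q_var ^ e j) = (\<Prod>j<Suc k. z_var * q_var ^ e j)"
    using has_formal_sum_distinct_partitions_length[OF assms] by blast
  have "distinct_partitions_length k \<inter> distinct_partitions_length (Suc k) = {}"
    by (auto simp: distinct_partitions_length_def)
  with S(1) T(1) have "has_formal_sum (weight g)
      (distinct_partitions_length k \<union> distinct_partitions_length (Suc k)) (S + T)"
    by (rule has_formal_sum_Un_disjoint)
  moreover have "(S + T) * (\<Prod>j<Suc k. 1 - z_var * q_var ^ e j) =
      (S * (\<Prod>j<k. 1 - z_var * q_var ^ e j)) * (1 - z_var * q_var ^ e k)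
        + T * (\<Prod>j<Suc k. 1 - z_var * q_var ^ e j)"
    by (simp add: algebra_simps)
  then have "(S + T) * (\<Prod>j<Suc k. 1 - z_var * q_var ^ e j) = (\<Prod>j<k. z_var * q_var ^ e j)"
    unfolding S(2) T(2) by (simp add: algebra_simps)
  ultimately show ?thesis by blast
qed

section \<open>Distinct partitions by length, and the cutoff\<close>

definition bounded_distinct_partitions :: "nat \<Rightarrow> (nat \<Rightarrow> nat) set" where
  "bounded_distinct_partitions k = {lam \<in> distinct_partitions. lam k = 0}"

lemma bounded_distinct_partitions_0: "bounded_distinct_partitions 0 = distinct_partitions_length 0"
  by (simp add: bounded_distinct_partitions_def distinct_partitions_length_def)

lemma bounded_distinct_partitions_Suc:
  "bounded_distinct_partitions (Suc k) = bounded_distinct_partitions k \<union> distinct_partitions_length (Suc k)"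
proof -
  have "lam (Suc k) = 0" if "lam \<in> distinct_partitions" "lam k = 0" for lam
    using partitions_antimono[of lam k "Suc k"] that by (simp add: distinct_partitions_def)
  moreover have "lam i \<noteq> 0" if "lam \<in> distinct_partitions" "lam k \<noteq> 0" "i < Suc k" for lam i
    using partitions_antimono[of lam i k] that by (simp add: distinct_partitions_def)
  ultimately show ?thesis
    by (auto simp: bounded_distinct_partitions_def distinct_partitions_length_def)
qed

lemma bounded_distinct_partitions_disjoint:
  "k < m \<Longrightarrow> bounded_distinct_partitions k \<inter> distinct_partitions_length m = {}"
  by (auto simp: bounded_distinct_partitions_def distinct_partitions_length_def)

text \<open>The counted parts decrease weakly and sum to \<open>n\<close>, so the one at position
  \<open>g n\<close> vanishes, and with it every later part.\<close>

lemma partition_weight_cutoff: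
  assumes "lam \<in> partitions" "strict_mono g" "fps_nth (weight g lam) n \<noteq> 0" "g n \<le> k"
  shows "lam k = 0"
proof -
  have fin: "finite {i. lam (g i) \<noteq> 0}"
    using finite_vimageI[OF finite_support_partition[OF assms(1)] strict_mono_imp_inj_on[OF assms(2)]]
    by (simp add: vimage_def)
  have "lam (g (Suc i)) \<le> lam (g i)" for i
    by (rule partitions_antimono[OF assms(1)]) (simp add: strict_mono_less_eq[OF assms(2)])
  then have "lam (g (\<Sum>i. lam (g i))) = 0"
    by (rule antimono_eq_0_at_sum[OF fin])
  then have "lam (g n) = 0" by (simp add: weight_nth_nonzero[OF assms(3)])
  then show ?thesis using partitions_antimono[OF assms(1,4)] by simp
qed

subsection \<open>Partition diamonds\<close>

definition bounded_diamonds :: "nat \<Rightarrow> (nat \<Rightarrow> nat) set" where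
  "bounded_diamonds k = {lam \<in> partition_diamonds. lam (3 * k) = 0}"

lemma partition_diamondsD:
  assumes "lam \<in> partition_diamonds"
  shows "lam (3 * k + 1) \<le> lam (3 * k)" "lam (3 * k + 2) \<le> lam (3 * k)"
    "lam (3 * k + 3) \<le> lam (3 * k + 1)" "lam (3 * k + 3) \<le> lam (3 * k + 2)"
  using assms unfolding partition_diamonds_def by blast+

lemma diamond_top_antimono:
  assumes "lam \<in> partition_diamonds" "i \<le> j"
  shows "lam (3 * j) \<le> lam (3 * i)"
proof -
  have "lam (3 * Suc n) \<le> lam (3 * n)" for n
    using partition_diamondsD(1,3)[OF assms(1), of n] by (simp add: add.commute)
  then show ?thesis using lift_Suc_antimono_le[of "\<lambda>i. lam (3 * i)" i j] assms(2) by simp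
qed

lemma diamond_le_top:
  assumes "lam \<in> partition_diamonds" "3 * k \<le> i"
  shows "lam i \<le> lam (3 * k)"
proof -
  define m r where "m = i div 3" and "r = i mod 3"
  have "i = 3 * m + r" "r < 3" by (simp_all add: m_def r_def)
  then have m: "i = 3 * m \<or> i = 3 * m + 1 \<or> i = 3 * m + 2" by linarith
  then have "lam i \<le> lam (3 * m)"
    using partition_diamondsD(1,2)[OF assms(1), of m] by blast
  also have "\<dots> \<le> lam (3 * k)"
    by (rule diamond_top_antimono[OF assms(1)]) (use assms(2) m in linarith)
  finally show ?thesis .
qed

lemma diamond_ge_bottom:
  assumes "lam \<in> partition_diamonds" "i \<le> 3 * k"
  shows "lam (3 * k) \<le> lam i"
proof -
  \<comment> \<open>\<open>m\<close> is \<open>i / 3\<close> rounded up, so \<open>3 * m\<close> is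
    the first multiple of 3 from \<open>i\<close> on.\<close>
  define m r where "m = (i + 2) div 3" and "r = (i + 2) mod 3"
  have "i + 2 = 3 * m + r" "r < 3" unfolding m_def r_def by simp_all
  then have m: "i = 3 * m \<or> i + 2 = 3 * m \<or> i + 1 = 3 * m" by linarith
  have "lam (3 * m) \<le> lam i"
  proof (cases "i = 3 * m")
    case False
    then obtain n where n: "m = Suc n" using m by (cases m) auto
    then have "i = 3 * n + 1 \<or> i = 3 * n + 2" "3 * m = 3 * n + 3" using m False by auto
    then show ?thesis using partition_diamondsD(3,4)[OF assms(1), of n] by metis
  qed simp
  moreover have "lam (3 * k) \<le> lam (3 * m)"
    by (rule diamond_top_antimono[OF assms(1)]) (use assms(2) m in linarith)
  ultimately show ?thesis by simp
qed

lemma partition_diamondsI: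
  assumes "\<And>i. i \<ge> n \<Longrightarrow> lam i = 0"
    "\<And>k. lam (3*k + 1) \<le> lam (3*k) \<and> lam (3*k + 2) \<le> lam (3*k) \<and>
          lam (3*k + 3) \<le> lam (3*k + 1) \<and> lam (3*k + 3) \<le> lam (3*k + 2)"
  shows "lam \<in> partition_diamonds"
proof -
  have "{i. lam i \<noteq> 0} \<subseteq> {..<n}" using assms(1) by (metis (mono_tags, lifting) lessThan_iff mem_Collect_eq not_less subsetI)
  then show ?thesis using assms(2) finite_subset unfolding partition_diamonds_def by blast
qed

text \<open>The layer ends at the new top \<open>3 * k\<close>. The two middle values after it are
  not comparable with each other, so they are set separately.\<close>

definition add_diamond :: "nat \<Rightarrow> (nat \<Rightarrow> nat) \<Rightarrow> nat \<times> nat \<times> nat \<Rightarrow> nat \<Rightarrow> nat" where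
  "add_diamond k lam = (\<lambda>(d, a, b). (add_layer (Suc (3 * k)) d lam)(3 * k + 1 := a, 3 * k + 2 := b))"

definition last_diamond_values :: "(nat \<times> nat \<times> nat) set" where
  "last_diamond_values = {(d, a, b). a \<le> d \<and> b \<le> d}"

lemma bounded_diamonds_eq_0: "lam \<in> bounded_diamonds k \<Longrightarrow> 3 * k \<le> i \<Longrightarrow> lam i = 0"
  using diamond_le_top[of lam k i] by (simp add: bounded_diamonds_def)

lemma add_diamond_apply:
  assumes "lam \<in> bounded_diamonds k"
  shows "add_diamond k lam (d, a, b) i = (if i < 3 * k then lam i + d else if i = 3 * k then d
    else if i = 3 * k + 1 then a else if i = 3 * k + 2 then b else 0)"
  using bounded_diamonds_eq_0[OF assms, of i]
  by (cases i "3 * k" rule: linorder_cases) (simp_all add: add_diamond_def add_layer_def)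

text \<open>In the image, the top \<open>mu (3 * k)\<close> is a lower bound for all earlier
  entries, so it can be subtracted from them without truncation; the values at and after it are
  recorded as the triple.\<close>

lemma bij_betw_bounded_diamonds:
  "bij_betw (\<lambda>(lam, v). add_diamond k lam v) (bounded_diamonds k \<times> last_diamond_values)
     (bounded_diamonds (Suc k))"
proof (rule bij_betw_byWitness[where f' = "\<lambda>mu. (\<lambda>i. if i < 3 * k then mu i - mu (3 * k) else 0,
       mu (3 * k), mu (3 * k + 1), mu (3 * k + 2))"])
  show "\<forall>p\<in>bounded_diamonds k \<times> last_diamond_values. (\<lambda>mu. (\<lambda>i. if i < 3 * k then mu i - mu (3 * k) else 0,
       mu (3 * k), mu (3 * k + 1), mu (3 * k + 2))) (case p of (lam, v) \<Rightarrow> add_diamond k lam v) = p"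
    by (clarsimp simp: add_diamond_apply bounded_diamonds_eq_0 fun_eq_iff)
  show "\<forall>mu\<in>bounded_diamonds (Suc k). (case (\<lambda>i. if i < 3 * k then mu i - mu (3 * k) else 0,
       mu (3 * k), mu (3 * k + 1), mu (3 * k + 2)) of (lam, v) \<Rightarrow> add_diamond k lam v) = mu"
  proof
    fix mu assume mu: "mu \<in> bounded_diamonds (Suc k)"
    have "mu (3 * k) \<le> mu i" if "i < 3 * k" for i
      using diamond_ge_bottom[of mu i k] that mu by (simp add: bounded_diamonds_def)
    moreover have "mu i = 0" if "i > 3 * k + 2" for i
      using bounded_diamonds_eq_0[OF mu, of i] that by simp
    ultimately have "add_diamond k (\<lambda>i. if i < 3 * k then mu i - mu (3 * k) else 0)
        (mu (3 * k), mu (3 * k + 1), mu (3 * k + 2)) i = mu i" for i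
      by (cases i "3 * k" rule: linorder_cases) (simp_all add: add_diamond_def add_layer_def)
    then show "(case (\<lambda>i. if i < 3 * k then mu i - mu (3 * k) else 0,
       mu (3 * k), mu (3 * k + 1), mu (3 * k + 2)) of (lam, v) \<Rightarrow> add_diamond k lam v) = mu"
      by (simp add: fun_eq_iff)
  qed
  show "(\<lambda>(lam, v). add_diamond k lam v) ` (bounded_diamonds k \<times> last_diamond_values) \<subseteq> bounded_diamonds (Suc k)"
  proof safe
    fix lam d a b assume lam: "lam \<in> bounded_diamonds k" and v: "(d, a, b) \<in> last_diamond_values"
    let ?mu = "add_diamond k lam (d, a, b)"
    note mu = add_diamond_apply[OF lam, of d a b]
    have "?mu \<in> partition_diamonds"
    proof (rule partition_diamondsI[of "3 * k + 3"])
      show "?mu (3*j + 1) \<le> ?mu (3*j) \<and> ?mu (3*j + 2) \<le> ?mu (3*j) \<and>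
          ?mu (3*j + 3) \<le> ?mu (3*j + 1) \<and> ?mu (3*j + 3) \<le> ?mu (3*j + 2)" for j
      proof -
        have l: "lam (3*j + 1) \<le> lam (3*j)" "lam (3*j + 2) \<le> lam (3*j)"
          "lam (3*j + 3) \<le> lam (3*j + 1)" "lam (3*j + 3) \<le> lam (3*j + 2)"
          using lam partition_diamondsD[of lam j] by (simp_all add: bounded_diamonds_def)
        \<comment> \<open>The case \<open>Suc j = k\<close> is separate because the bottom of block
          \<open>j\<close> is the new top, with value \<open>d\<close>.\<close>
        consider "j > k" | "j = k" | "Suc j = k" | "Suc j < k" by linarith
        then show ?thesis
          unfolding mu using l v by cases (simp_all add: last_diamond_values_def)
      qed
    qed (simp add: mu)
    then show "?mu \<in> bounded_diamonds (Suc k)" by (simp add: bounded_diamonds_def mu)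
  qed
  show "(\<lambda>mu. (\<lambda>i. if i < 3 * k then mu i - mu (3 * k) else 0, mu (3 * k), mu (3 * k + 1), mu (3 * k + 2))) `
      bounded_diamonds (Suc k) \<subseteq> bounded_diamonds k \<times> last_diamond_values"
  proof (rule image_subsetI)
    fix mu assume mu: "mu \<in> bounded_diamonds (Suc k)"
    let ?l = "\<lambda>i. if i < 3 * k then mu i - mu (3 * k) else 0"
    have m: "mu (3*j + 1) \<le> mu (3*j)" "mu (3*j + 2) \<le> mu (3*j)"
          "mu (3*j + 3) \<le> mu (3*j + 1)" "mu (3*j + 3) \<le> mu (3*j + 2)" for j
      using mu partition_diamondsD[of mu j] by (simp_all add: bounded_diamonds_def)
    have "?l \<in> partition_diamonds"
    proof (rule partition_diamondsI[of "3 * k"])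
      show "?l (3*j + 1) \<le> ?l (3*j) \<and> ?l (3*j + 2) \<le> ?l (3*j) \<and>
          ?l (3*j + 3) \<le> ?l (3*j + 1) \<and> ?l (3*j + 3) \<le> ?l (3*j + 2)" for j
        using m[of j] by (auto intro: diff_le_mono)
    qed simp
    then show "(?l, mu (3 * k), mu (3 * k + 1), mu (3 * k + 2)) \<in> bounded_diamonds k \<times> last_diamond_values"
      using m[of k] by (simp add: bounded_diamonds_def last_diamond_values_def)
  qed
qed

text \<open>Splitting at \<open>a \<le> b\<close> versus \<open>a > b\<close> turns each half into three free gaps.\<close>

lemma has_formal_sum_last_diamond_values:
  assumes "has_formal_sum (\<lambda>d. x ^ d) UNIV G"
  shows "has_formal_sum (\<lambda>(d, a, b). x ^ d) last_diamond_values ((1 + x) * G ^ 3)"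
proof -
  have G3: "has_formal_sum (\<lambda>(u, v, w). x ^ (u + v + w)) UNIV (G ^ 3)"
    using has_formal_sum_times[OF assms has_formal_sum_times[OF assms assms]]
    by (simp add: power_add power3_eq_cube case_prod_unfold mult.assoc)
  have "has_formal_sum (\<lambda>(d, a, b). x ^ d) {(d, a, b). a \<le> b \<and> b \<le> d} (G ^ 3)"
  proof (rule has_formal_sum_reindex[OF G3])
    show "bij_betw (\<lambda>(u, v, w). (u + v + w, u, u + v)) UNIV {(d, a, b). a \<le> b \<and> b \<le> (d::nat)}"
      by (rule bij_betw_byWitness[where f' = "\<lambda>(d, a, b). (a, b - a, d - b)"]) auto
  qed auto
  \<comment> \<open>The strict inequality makes \<open>d\<close> one more than the sum of the three
    gaps, hence the additional factor \<open>x\<close>.\<close>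
  moreover have "has_formal_sum (\<lambda>(d, a, b). x ^ d) {(d, a, b). b < a \<and> a \<le> d} (x * G ^ 3)"
  proof (rule has_formal_sum_reindex[OF has_formal_sum_cmult[OF G3]])
    show "bij_betw (\<lambda>(u, v, w). (Suc (u + v + w), Suc (u + v), u)) UNIV {(d, a, b). b < a \<and> a \<le> (d::nat)}"
      by (rule bij_betw_byWitness[where f' = "\<lambda>(d, a, b). (b, a - Suc b, d - a)"]) auto
  qed auto
  ultimately have "has_formal_sum (\<lambda>(d, a, b). x ^ d)
      ({(d, a, b). a \<le> b \<and> b \<le> d} \<union> {(d, a, b). b < a \<and> a \<le> d}) (G ^ 3 + x * G ^ 3)"
    by (rule has_formal_sum_Un_disjoint) auto
  moreover have "{(d, a, b). a \<le> b \<and> b \<le> d} \<union> {(d, a, b). b < a \<and> a \<le> d} = last_diamond_values"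
    by (auto simp: last_diamond_values_def)
  ultimately show ?thesis by (simp add: algebra_simps)
qed

text \<open>The overwritten positions are not multiples of 3, so the weight sees only the layer,
  which covers the \<open>k + 1\<close> tops.\<close>

lemma weight_add_diamond:
  assumes "lam \<in> bounded_diamonds k"
  shows "weight ((*) 3) (add_diamond k lam (d, a, b)) =
    weight ((*) 3) lam * (z_var * q_var ^ Suc k) ^ d"
proof -
  have "add_diamond k lam (d, a, b) (3 * i) = add_layer (Suc (3 * k)) d lam (3 * i)" for i
  proof -
    have "3 * i \<noteq> 3 * k + 1" "3 * i \<noteq> 3 * k + 2" by presburger+
    then show ?thesis by (simp add: add_diamond_def)
  qed
  moreover from this[of 0] have "add_diamond k lam (d, a, b) 0 = add_layer (Suc (3 * k)) d lam 0"
    by simp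
  ultimately have "weight ((*) 3) (add_diamond k lam (d, a, b)) =
      weight ((*) 3) (add_layer (Suc (3 * k)) d lam)"
    by (simp add: weight_def)
  also have "\<dots> = weight ((*) 3) lam * (z_var * q_var ^ Suc k) ^ d"
    by (rule weight_add_layer)
       (use assms in \<open>auto simp: bounded_diamonds_def partition_diamonds_def inj_on_def\<close>)
  finally show ?thesis .
qed

lemma bounded_diamonds_0: "bounded_diamonds 0 = {\<lambda>_. 0}"
proof -
  have "lam = (\<lambda>_. 0)" if "lam \<in> bounded_diamonds 0" for lam
    using that diamond_le_top[of lam 0] by (simp add: bounded_diamonds_def fun_eq_iff)
  moreover have "(\<lambda>_. 0) \<in> bounded_diamonds 0"
    by (simp add: bounded_diamonds_def partition_diamonds_def)
  ultimately show ?thesis by blast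
qed

text \<open>With \<open>x = z * q ^ (k + 1)\<close>, the last diamond contributes
  \<open>(1 + x) / (1 - x) ^ 3\<close>; the factor \<open>1 + x\<close> extends the q-Pochhammer
  symbol at \<open>- z * q\<close>.\<close>

lemma has_formal_sum_bounded_diamonds:
  "\<exists>S :: 'a::comm_ring_1 fps fps. has_formal_sum (weight ((*) 3)) (bounded_diamonds k) S \<and>
    S * qpochhammer (z_var * q_var) q_var k ^ 3 = qpochhammer (- z_var * q_var) q_var k"
proof (induction k)
  case 0
  show ?case
    using has_formal_sum_singleton[of "weight ((*) 3)" "\<lambda>_. 0"] by (auto simp: bounded_diamonds_0)
next
  case (Suc k)
  let ?x = "z_var * q_var ^ Suc k :: 'a fps fps"
  from Suc obtain S :: "'a fps fps" where S: "has_formal_sum (weight ((*) 3)) (bounded_diamonds k) S"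
    "S * qpochhammer (z_var * q_var) q_var k ^ 3 = qpochhammer (- z_var * q_var) q_var k" by blast
  obtain G :: "'a fps fps" where G: "has_formal_sum (\<lambda>d. ?x ^ d) UNIV G" "G * (1 - ?x) = 1"
    by (rule has_formal_sum_geometric)
  have "has_formal_sum (weight ((*) 3)) (bounded_diamonds (Suc k)) (S * ((1 + ?x) * G ^ 3))"
    by (rule has_formal_sum_reindex[OF has_formal_sum_times[OF S(1)
          has_formal_sum_last_diamond_values[OF G(1)]] bij_betw_bounded_diamonds])
       (auto simp: weight_add_diamond simp del: power_Suc)
  moreover have "S * ((1 + ?x) * G ^ 3) * qpochhammer (z_var * q_var) q_var (Suc k) ^ 3 =
      (S * qpochhammer (z_var * q_var) q_var k ^ 3) * (1 + ?x) * (G * (1 - ?x)) ^ 3"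
    by (simp add: qpochhammer_Suc power_mult_distrib mult_ac)
  then have "S * ((1 + ?x) * G ^ 3) * qpochhammer (z_var * q_var) q_var (Suc k) ^ 3 =
      qpochhammer (- z_var * q_var) q_var (Suc k)"
    unfolding S(2) G(2) by (simp add: qpochhammer_Suc mult_ac)
  ultimately show ?case by blast
qed

lemma diamond_weight_cutoff:
  assumes "lam \<in> partition_diamonds" "fps_nth (weight ((*) 3) lam) n \<noteq> 0" "n \<le> k"
  shows "lam (3 * k) = 0"
proof -
  have "finite {i. lam (3 * i) \<noteq> 0}"
    using finite_vimageI[of "{i. lam i \<noteq> 0}" "(*) 3"] assms(1)
    by (simp add: vimage_def partition_diamonds_def inj_on_def)
  then have "lam (3 * (\<Sum>i. lam (3 * i))) = 0"
    by (rule antimono_eq_0_at_sum) (rule diamond_top_antimono[OF assms(1) le_SucI[OF order.refl]])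
  then have "lam (3 * n) = 0" by (simp add: weight_nth_nonzero[OF assms(2)])
  then show ?thesis using diamond_top_antimono[OF assms(1,3)] by simp
qed


subsection \<open>Passing to the limit\<close>

text \<open>The cleared identities \<open>S k * D k = N k\<close> pass to the limit by continuity of
  multiplication, and only then is the unit \<open>D'\<close> divided out.\<close>

lemma has_formal_sum_quotient_limit:
  fixes f :: "'i \<Rightarrow> 'a::field fps fps"
  assumes S: "\<And>k. \<exists>S. has_formal_sum f (A k) S \<and> S * D k = N k"
    and ev: "\<And>n. \<forall>\<^sub>F k in sequentially. \<forall>x. fps_nth (f x) n \<noteq> 0 \<longrightarrow> (x \<in> A k \<longleftrightarrow> x \<in> B)"
    and lim: "D \<longlonglongrightarrow> D'" "N \<longlonglongrightarrow> N'" and D': "fps_nth (fps_nth D' 0) 0 \<noteq> 0"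
  shows "has_formal_sum f B (N' / D')"
proof -
  obtain S where S: "\<And>k. has_formal_sum f (A k) (S k)" "\<And>k. S k * D k = N k"
    using S by metis
  obtain T where T: "has_formal_sum f B T" "S \<longlonglongrightarrow> T"
    using has_formal_sum_limit[OF S(1) ev] by blast
  have "(\<lambda>k. S k * D k) \<longlonglongrightarrow> T * D'"
    by (intro tendsto_mult_fps T lim)
  then have "T * D' = N'" using lim(2) unfolding S(2) by (rule LIMSEQ_unique)
  then have "N' / D' = T" using D' by (rule fps_fps_divide_eqI)
  with T(1) show ?thesis by simp
qed

section \<open>Products over even and odd positions\<close>

lemma qpochhammer_zq:
  "qpochhammer (z_var * q_var) q_var n = (\<Prod>j<n. 1 - z_var * q_var ^ Suc j)"
  by (simp add: qpochhammer_def mult.assoc)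

lemma qpochhammer_fps_nth_0:
  "fps_nth (qpochhammer a fps_X n) 0 = (if n = 0 then 1 else 1 - fps_nth a 0)"
  by (induction n) (auto simp: qpochhammer_Suc)

text \<open>The index \<open>Suc (j div 2)\<close> runs through 1, 1, 2, 2, up to \<open>n\<close>,
  \<open>n\<close>.\<close>

lemma even_prod_lessThan:
  fixes f :: "nat \<Rightarrow> 'a::comm_monoid_mult"
  shows "(\<Prod>j<2*n. f (Suc (j div 2))) = (\<Prod>j<n. f (Suc j)) * (\<Prod>j<n. f (Suc j))"
  by (induction n) (auto simp: mult_ac)

lemma odd_prod_lessThan:
  fixes f :: "nat \<Rightarrow> 'a::comm_monoid_mult"
  shows "(\<Prod>j<Suc (2*n). f ((j + 1) div 2)) = f 0 * ((\<Prod>j<n. f (Suc j)) * (\<Prod>j<n. f (Suc j)))"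
  by (induction n) (auto simp: mult_ac)

text \<open>This and the next lemma supply the layer exponents \<open>e\<close>: 1, 1, 2, 2, ...
  when even positions are counted, and 0, 1, 1, 2, 2, ... for odd ones.\<close>

lemma even_index_set: "{i. 2 * i < Suc k} = {..<Suc (k div 2)}"
  by auto

lemma odd_index_set: "{i. 2 * i + 1 < Suc k} = {..<(k + 1) div 2}"
  by auto

text \<open>The cutoff \<open>g n\<close> is good for every larger bound too, so the bounds may run
  along a subsequence \<open>h\<close> of suitable parity.\<close>

lemma partitions_eventually_bounded:
  fixes g h :: "nat \<Rightarrow> nat"
  assumes "strict_mono g" "A \<subseteq> partitions" "\<And>k. k \<le> h k"
  shows "\<forall>\<^sub>F k in sequentially. \<forall>lam. fps_nth (weight g lam :: 'a::comm_ring_1 fps fps) n \<noteq> 0 \<longrightarrow>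
     (lam \<in> {lam \<in> A. lam (h k) = 0} \<longleftrightarrow> lam \<in> A)"
  unfolding eventually_sequentially
proof (intro exI[of _ "g n"] allI impI)
  fix k lam assume "g n \<le> k" "fps_nth (weight g lam :: 'a fps fps) n \<noteq> 0"
  then show "lam \<in> {lam \<in> A. lam (h k) = 0} \<longleftrightarrow> lam \<in> A"
    using partition_weight_cutoff[of lam g n "h k"] assms(1,2) assms(3)[of k] by auto
qed

text \<open>An even bound on the number of parts makes the denominator an exact square.\<close>

lemma has_formal_sum_partitions_even:
  "has_formal_sum (weight ((*) 2)) partitions
     (1 / (qpochhammer_inf (z_var * q_var) q_var :: 'a::field fps fps)\<^sup>2)"
proof (rule has_formal_sum_quotient_limit)
  note tends = qpochhammer_tendsto[of "z_var * fps_X :: 'a fps fps", folded q_var_def]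
  show "\<exists>S :: 'a fps fps. has_formal_sum (weight ((*) 2)) (bounded_partitions (2 * k)) S \<and>
      S * (qpochhammer (z_var * q_var) q_var k)\<^sup>2 = 1" for k
    using has_formal_sum_bounded_partitions[of "(*) 2", OF _ even_index_set, of "2 * k", where 'a = 'a]
      even_prod_lessThan[of "\<lambda>j. 1 - z_var * q_var ^ j :: 'a fps fps" k]
    by (simp add: qpochhammer_zq power2_eq_square inj_on_def del: power_Suc)
  show "\<forall>\<^sub>F k in sequentially. \<forall>lam. fps_nth (weight ((*) 2) lam :: 'a fps fps) n \<noteq> 0 \<longrightarrow>
     (lam \<in> bounded_partitions (2 * k) \<longleftrightarrow> lam \<in> partitions)" for n
    unfolding bounded_partitions_def by (rule partitions_eventually_bounded) (auto simp: strict_mono_def)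
  show "(\<lambda>k. (qpochhammer (z_var * q_var) q_var k :: 'a fps fps)\<^sup>2) \<longlonglongrightarrow>
      (qpochhammer_inf (z_var * q_var) q_var)\<^sup>2"
    by (intro tendsto_power_fps tends) (simp add: q_var_def)
  show "fps_nth (fps_nth ((qpochhammer_inf (z_var * q_var) q_var :: 'a fps fps)\<^sup>2) 0) 0 \<noteq> 0"
    using tends(2) by (simp add: q_var_def power2_eq_square)
qed auto

text \<open>The layer of length 1 covers no counted position and yields the factor
  \<open>1 - z\<close>; the other \<open>2 * k\<close> layers pair up.\<close>

lemma has_formal_sum_partitions_odd:
  "has_formal_sum (weight (\<lambda>i. 2 * i + 1)) partitions
     (1 / ((1 - z_var) * (qpochhammer_inf (z_var * q_var) q_var :: 'a::field fps fps)\<^sup>2))"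
proof (rule has_formal_sum_quotient_limit)
  note tends = qpochhammer_tendsto[of "z_var * fps_X :: 'a fps fps", folded q_var_def]
  show "\<exists>S :: 'a fps fps. has_formal_sum (weight (\<lambda>i. 2 * i + 1)) (bounded_partitions (Suc (2 * k))) S \<and>
      S * ((1 - z_var) * (qpochhammer (z_var * q_var) q_var k)\<^sup>2) = 1" for k
    using has_formal_sum_bounded_partitions[of "\<lambda>i. 2 * i + 1", OF _ odd_index_set, of "Suc (2 * k)", where 'a = 'a]
      odd_prod_lessThan[of "\<lambda>j. 1 - z_var * q_var ^ j :: 'a fps fps" k]
    by (simp add: qpochhammer_zq power2_eq_square inj_on_def del: power_Suc prod.lessThan_Suc)
  show "\<forall>\<^sub>F k in sequentially. \<forall>lam. fps_nth (weight (\<lambda>i. 2 * i + 1) lam :: 'a fps fps) n \<noteq> 0 \<longrightarrow>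
     (lam \<in> bounded_partitions (Suc (2 * k)) \<longleftrightarrow> lam \<in> partitions)" for n
    unfolding bounded_partitions_def by (rule partitions_eventually_bounded) (auto simp: strict_mono_def)
  show "(\<lambda>k. (1 - z_var) * (qpochhammer (z_var * q_var) q_var k :: 'a fps fps)\<^sup>2) \<longlonglongrightarrow>
      (1 - z_var) * (qpochhammer_inf (z_var * q_var) q_var)\<^sup>2"
    by (intro tendsto_mult_fps tendsto_power_fps tends tendsto_const) (simp add: q_var_def)
  show "fps_nth (fps_nth ((1 - z_var) * (qpochhammer_inf (z_var * q_var) q_var :: 'a fps fps)\<^sup>2) 0) 0 \<noteq> 0"
    using tends(2) by (simp add: q_var_def z_var_def power2_eq_square)
qed auto

lemma has_formal_sum_diamonds:
  "has_formal_sum (weight ((*) 3)) partition_diamonds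
     (qpochhammer_inf (- z_var * q_var) q_var / (qpochhammer_inf (z_var * q_var) q_var :: 'a::field fps fps) ^ 3)"
proof (rule has_formal_sum_quotient_limit)
  note tends = qpochhammer_tendsto[of "z_var * fps_X :: 'a fps fps", folded q_var_def]
  show "\<exists>S :: 'a fps fps. has_formal_sum (weight ((*) 3)) (bounded_diamonds k) S \<and>
      S * qpochhammer (z_var * q_var) q_var k ^ 3 = qpochhammer (- z_var * q_var) q_var k" for k
    by (rule has_formal_sum_bounded_diamonds)
  show "\<forall>\<^sub>F k in sequentially. \<forall>lam. fps_nth (weight ((*) 3) lam :: 'a fps fps) n \<noteq> 0 \<longrightarrow>
     (lam \<in> bounded_diamonds k \<longleftrightarrow> lam \<in> partition_diamonds)" for n
    using diamond_weight_cutoff[where 'a = 'a] by (auto simp: eventually_sequentially bounded_diamonds_def)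
  show "(\<lambda>k. (qpochhammer (z_var * q_var) q_var k :: 'a fps fps) ^ 3) \<longlonglongrightarrow>
      qpochhammer_inf (z_var * q_var) q_var ^ 3"
    by (intro tendsto_power_fps tends) (simp add: q_var_def)
  show "(\<lambda>k. qpochhammer (- z_var * q_var) q_var k :: 'a fps fps) \<longlonglongrightarrow>
      qpochhammer_inf (- z_var * q_var) q_var"
    using qpochhammer_tendsto(1)[of "- z_var * fps_X :: 'a fps fps"] by (simp add: q_var_def)
  show "fps_nth (fps_nth ((qpochhammer_inf (z_var * q_var) q_var :: 'a fps fps) ^ 3) 0) 0 \<noteq> 0"
    using tends(2) by (simp add: q_var_def power3_eq_cube)
qed

section \<open>The series for distinct partitions\<close>

lemma prod_zq_square:
  "(\<Prod>j<n. z * q ^ Suc j) * (\<Prod>j<n. z * q ^ Suc j) = z ^ (2 * n) * q ^ (n * (n + 1))"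
  for z q :: "'a::comm_monoid_mult"
proof (induction n)
  case (Suc n)
  have "(\<Prod>j<Suc n. z * q ^ Suc j) * (\<Prod>j<Suc n. z * q ^ Suc j) =
      ((\<Prod>j<n. z * q ^ Suc j) * (\<Prod>j<n. z * q ^ Suc j)) * (z ^ 2 * (q ^ Suc n * q ^ Suc n))"
    by (simp only: prod.lessThan_Suc power2_eq_square mult_ac)
  also have "\<dots> = z ^ (2 * Suc n) * q ^ (Suc n * (Suc n + 1))"
  proof -
    \<comment> \<open>The exponent \<open>n * (n + 1)\<close> is twice a triangular number, so it
      grows by \<open>2 * (n + 1)\<close>.\<close>
    have "2 * Suc n = 2 * n + 2" "Suc n * (Suc n + 1) = n * (n + 1) + (Suc n + Suc n)" by simp_all
    then show ?thesis unfolding Suc.IH by (simp only: power_add mult_ac)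
  qed
  finally show ?case .
qed simp

text \<open>The denominator exponents are 1, 1, up to \<open>n\<close>, \<open>n\<close>, followed
  by a single \<open>n + 1\<close>, which completes the longer of the two q-Pochhammer
  symbols.\<close>

lemma has_formal_sum_distinct_pair_even:
  "has_formal_sum (weight ((*) 2)) (distinct_partitions_length (2 * n) \<union> distinct_partitions_length (Suc (2 * n)))
     (z_var ^ (2 * n) * q_var ^ (n * (n + 1)) /
       (qpochhammer (z_var * q_var) q_var n * qpochhammer (z_var * q_var) q_var (n + 1)) :: 'a::field fps fps)"
proof -
  let ?D = "qpochhammer (z_var * q_var) q_var n * qpochhammer (z_var * q_var) q_var (n + 1) :: 'a fps fps"
  obtain S :: "'a fps fps" where S: "has_formal_sum (weight ((*) 2))
      (distinct_partitions_length (2 * n) \<union> distinct_partitions_length (Suc (2 * n))) S"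
    "S * (\<Prod>j<Suc (2 * n). 1 - z_var * q_var ^ Suc (j div 2)) = (\<Prod>j<2 * n. z_var * q_var ^ Suc (j div 2))"
    using has_formal_sum_distinct_partitions_length_or_Suc[of "(*) 2", OF _ even_index_set, of "2 * n", where 'a = 'a]
    by (auto simp: inj_on_def)
  have "(\<Prod>j<Suc (2 * n). 1 - z_var * q_var ^ Suc (j div 2)) = ?D"
    unfolding prod.lessThan_Suc[of _ "2 * n"] qpochhammer_zq
      even_prod_lessThan[of "\<lambda>j. 1 - z_var * q_var ^ j :: 'a fps fps" n]
    by (simp add: mult_ac del: power_Suc)
  moreover have "(\<Prod>j<2 * n. z_var * q_var ^ Suc (j div 2)) = (z_var ^ (2 * n) * q_var ^ (n * (n + 1)) :: 'a fps fps)"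
    by (simp only: even_prod_lessThan[of "\<lambda>j. z_var * q_var ^ j :: 'a fps fps" n] prod_zq_square)
  ultimately have "S * ?D = z_var ^ (2 * n) * q_var ^ (n * (n + 1))" using S(2) by metis
  moreover have "fps_nth (fps_nth ?D 0) 0 \<noteq> 0" by (simp add: q_var_def qpochhammer_fps_nth_0)
  ultimately show ?thesis using S(1) fps_fps_divide_eqI by metis
qed

text \<open>The denominator exponents are 0, then 1, 1, up to \<open>n\<close>, \<open>n\<close>,
  then \<open>n + 1\<close>. The 0 begins the symbol at \<open>z\<close> and the
  \<open>n + 1\<close> ends the one at \<open>z * q\<close>; exponent 0 also gives the odd power of
  \<open>z\<close> in the numerator.\<close>

lemma has_formal_sum_distinct_pair_odd:
  "has_formal_sum (weight (\<lambda>i. 2 * i + 1))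
     (distinct_partitions_length (Suc (2 * n)) \<union> distinct_partitions_length (Suc (Suc (2 * n))))
     (z_var ^ (2 * Suc n - 1) * q_var ^ (Suc n * (Suc n - 1)) /
       (qpochhammer z_var q_var (Suc n) * qpochhammer (z_var * q_var) q_var (Suc n)) :: 'a::field fps fps)"
proof -
  let ?D = "qpochhammer z_var q_var (Suc n) * qpochhammer (z_var * q_var) q_var (Suc n) :: 'a fps fps"
  let ?N = "z_var ^ (2 * Suc n - 1) * q_var ^ (Suc n * (Suc n - 1)) :: 'a fps fps"
  obtain S :: "'a fps fps" where S: "has_formal_sum (weight (\<lambda>i. 2 * i + 1))
     (distinct_partitions_length (Suc (2 * n)) \<union> distinct_partitions_length (Suc (Suc (2 * n)))) S"
    "S * (\<Prod>j<Suc (Suc (2 * n)). 1 - z_var * q_var ^ ((j + 1) div 2)) =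
      (\<Prod>j<Suc (2 * n). z_var * q_var ^ ((j + 1) div 2))"
    using has_formal_sum_distinct_partitions_length_or_Suc
      [of "\<lambda>i. 2 * i + 1", OF _ odd_index_set, of "Suc (2 * n)", where 'a = 'a]
    by (auto simp: inj_on_def simp del: prod.lessThan_Suc)
  have z: "qpochhammer z_var q_var (Suc n) = (1 - z_var) * (\<Prod>j<n. 1 - z_var * q_var ^ Suc j :: 'a fps fps)"
    unfolding qpochhammer_def prod.lessThan_Suc_shift by simp
  have "(\<Prod>j<Suc (Suc (2 * n)). 1 - z_var * q_var ^ ((j + 1) div 2)) =
      (\<Prod>j<Suc (2 * n). 1 - z_var * q_var ^ ((j + 1) div 2)) * (1 - z_var * q_var ^ Suc n :: 'a fps fps)"
    by (subst prod.lessThan_Suc) simp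
  also have "\<dots> = ?D"
    unfolding odd_prod_lessThan[of "\<lambda>j. 1 - z_var * q_var ^ j :: 'a fps fps" n] z qpochhammer_zq
    by (simp add: mult_ac del: power_Suc)
  finally have D: "(\<Prod>j<Suc (Suc (2 * n)). 1 - z_var * q_var ^ ((j + 1) div 2)) = ?D" .
  have "(\<Prod>j<Suc (2 * n). z_var * q_var ^ ((j + 1) div 2)) = ?N"
    unfolding odd_prod_lessThan[of "\<lambda>j. z_var * q_var ^ j :: 'a fps fps" n] prod_zq_square
    by (simp add: mult_ac)
  with D have "S * ?D = ?N" using S(2) by metis
  moreover have "fps_nth (fps_nth ?D 0) 0 \<noteq> 0"
    by (simp add: q_var_def z_var_def qpochhammer_fps_nth_0)
  ultimately show ?thesis using S(1) fps_fps_divide_eqI by metis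
qed

lemma distinct_partitions_subset: "distinct_partitions \<subseteq> partitions"
  by (auto simp: distinct_partitions_def)

text \<open>The length pairs (0, 1), (2, 3), ... exhaust all lengths, so partial sums count the
  distinct partitions with at most \<open>2 * N + 1\<close> parts.\<close>

lemma has_formal_sum_distinct_even:
  "has_formal_sum (weight ((*) 2)) distinct_partitions
     (\<Sum>n. z_var ^ (2 * n) * q_var ^ (n * (n + 1)) /
       (qpochhammer (z_var * q_var) q_var n * qpochhammer (z_var * q_var) q_var (n + 1)) :: 'a::field fps fps)"
proof -
  define T :: "nat \<Rightarrow> 'a fps fps" where "T = (\<lambda>n. z_var ^ (2 * n) * q_var ^ (n * (n + 1)) /
       (qpochhammer (z_var * q_var) q_var n * qpochhammer (z_var * q_var) q_var (n + 1)))"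
  have T: "has_formal_sum (weight ((*) 2))
      (distinct_partitions_length (2 * n) \<union> distinct_partitions_length (Suc (2 * n))) (T n)" for n
    unfolding T_def by (rule has_formal_sum_distinct_pair_even)
  have S: "has_formal_sum (weight ((*) 2)) (bounded_distinct_partitions (Suc (2 * N))) (\<Sum>n\<le>N. T n)" for N
  proof (induction N)
    case 0
    show ?case using T[of 0] by (simp add: bounded_distinct_partitions_Suc bounded_distinct_partitions_0)
  next
    case (Suc N)
    have "bounded_distinct_partitions (Suc (2 * N)) \<inter>
        (distinct_partitions_length (2 * Suc N) \<union> distinct_partitions_length (Suc (2 * Suc N))) = {}"
      by (simp add: Int_Un_distrib bounded_distinct_partitions_disjoint)
    from has_formal_sum_Un_disjoint[OF Suc T this] show ?case
      by (simp add: bounded_distinct_partitions_Suc Un_assoc)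
  qed
  have "\<exists>L. has_formal_sum (weight ((*) 2)) distinct_partitions L \<and> (\<lambda>N. \<Sum>n\<le>N. T n) \<longlonglongrightarrow> L"
    by (rule has_formal_sum_limit[OF S], unfold bounded_distinct_partitions_def,
        rule partitions_eventually_bounded[OF _ distinct_partitions_subset]) (auto simp: strict_mono_def)
  then obtain L where L: "has_formal_sum (weight ((*) 2)) distinct_partitions L" "(\<lambda>N. \<Sum>n\<le>N. T n) \<longlonglongrightarrow> L"
    by blast
  then have "L = (\<Sum>n. T n)" using sums_unique[of T L] by (simp add: sums_def_le)
  with L(1) show ?thesis by (simp add: T_def)
qed

text \<open>The pairs are (1, 2), (3, 4), ..., and the isolated summand 1 is the empty
  partition.\<close>

lemma has_formal_sum_distinct_odd:
  "has_formal_sum (weight (\<lambda>i. 2 * i + 1)) distinct_partitions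
     (1 + (\<Sum>n. z_var ^ (2 * Suc n - 1) * q_var ^ (Suc n * (Suc n - 1)) /
       (qpochhammer z_var q_var (Suc n) * qpochhammer (z_var * q_var) q_var (Suc n))) :: 'a::field fps fps)"
proof -
  define T :: "nat \<Rightarrow> 'a fps fps" where "T = (\<lambda>n. z_var ^ (2 * Suc n - 1) * q_var ^ (Suc n * (Suc n - 1)) /
       (qpochhammer z_var q_var (Suc n) * qpochhammer (z_var * q_var) q_var (Suc n)))"
  let ?w = "weight (\<lambda>i. 2 * i + 1) :: _ \<Rightarrow> 'a fps fps"
  have T: "has_formal_sum ?w
      (distinct_partitions_length (Suc (2 * n)) \<union> distinct_partitions_length (Suc (Suc (2 * n)))) (T n)" for n
    unfolding T_def by (rule has_formal_sum_distinct_pair_odd)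
  have S: "has_formal_sum ?w (bounded_distinct_partitions (2 * N)) (1 + (\<Sum>n<N. T n))" for N
  proof (induction N)
    case 0
    show ?case using has_formal_sum_singleton[of ?w "\<lambda>_. 0"]
      by (simp add: bounded_distinct_partitions_0 distinct_partitions_length_0)
  next
    case (Suc N)
    have "bounded_distinct_partitions (2 * N) \<inter>
        (distinct_partitions_length (Suc (2 * N)) \<union> distinct_partitions_length (Suc (Suc (2 * N)))) = {}"
      by (simp add: Int_Un_distrib bounded_distinct_partitions_disjoint)
    from has_formal_sum_Un_disjoint[OF Suc T this] show ?case
      by (simp add: bounded_distinct_partitions_Suc Un_assoc add.assoc)
  qed
  have "\<exists>L. has_formal_sum ?w distinct_partitions L \<and> (\<lambda>N. 1 + (\<Sum>n<N. T n)) \<longlonglongrightarrow> L"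
    by (rule has_formal_sum_limit[OF S], unfold bounded_distinct_partitions_def,
        rule partitions_eventually_bounded[OF _ distinct_partitions_subset]) (auto simp: strict_mono_def)
  then obtain L where L: "has_formal_sum ?w distinct_partitions L" "(\<lambda>N. 1 + (\<Sum>n<N. T n)) \<longlonglongrightarrow> L"
    by blast
  \<comment> \<open>The leading 1 is removed coefficientwise to turn the limit into an ordinary
    infinite sum.\<close>
  have "T sums (L - 1)"
    unfolding sums_def tendsto_fps_iff
  proof
    fix n
    have "\<forall>\<^sub>F N in sequentially. fps_nth (1 + (\<Sum>n<N. T n)) n = fps_nth L n"
      using L(2) unfolding tendsto_fps_iff by blast
    then show "\<forall>\<^sub>F N in sequentially. fps_nth (\<Sum>n<N. T n) n = fps_nth (L - 1) n"
      by eventually_elim (simp add: algebra_simps)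
  qed
  then have "L = 1 + (\<Sum>n. T n)" using sums_unique[of T "L - 1"] by (simp add: algebra_simps)
  with L(1) show ?thesis by (simp add: T_def)
qed

theorem theorem1p5:
  fixes z q :: "'a::field fps fps"
  assumes z: "z = z_var" and q: "q = q_var"
  shows
    "has_formal_sum (\<lambda>lam. z ^ lam 0 * q ^ (\<Sum>i. lam (2*i))) distinct_partitions
       (\<Sum>n. z ^ (2*n) * q ^ (n*(n+1)) / (qpochhammer (z*q) q n * qpochhammer (z*q) q (n+1))) \<and>
     has_formal_sum (\<lambda>lam. z ^ lam 0 * q ^ (\<Sum>i. lam (2*i + 1))) distinct_partitions
       (1 + (\<Sum>n. z ^ (2 * Suc n - 1) * q ^ (Suc n * (Suc n - 1)) /
                 (qpochhammer z q (Suc n) * qpochhammer (z*q) q (Suc n)))) \<and>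
     has_formal_sum (\<lambda>lam. z ^ lam 0 * q ^ (\<Sum>i. lam (2*i))) partitions
       (1 / (qpochhammer_inf (z*q) q)^2) \<and>
     has_formal_sum (\<lambda>lam. z ^ lam 0 * q ^ (\<Sum>i. lam (2*i + 1))) partitions
       (1 / ((1 - z) * (qpochhammer_inf (z*q) q)^2)) \<and>
     has_formal_sum (\<lambda>lam. z ^ lam 0 * q ^ (\<Sum>i. lam (3*i))) partition_diamonds
       (qpochhammer_inf (- z*q) q / (qpochhammer_inf (z*q) q)^3)"
proof -
  show ?thesis
    unfolding z q
    by (intro conjI has_formal_sum_distinct_even[unfolded weight_def]
      has_formal_sum_distinct_odd[unfolded weight_def] has_formal_sum_partitions_even[unfolded weight_def]
      has_formal_sum_partitions_odd[unfolded weight_def] has_formal_sum_diamonds[unfolded weight_def])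
qed

end
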